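(* Let $G$ be the simple graph on the vertex set $\{a,b,c,d,z\}$ with edge set $$E(G)=\{ab,ac,ad,az,bc,bd,bz,cd\},$$ and let $e=az$ and $f=cd$. Let the edge weights be i.i.d. with an atomless law and let $T$ be the almost surely unique minimum spanning tree. Then $$\mathbf{P}(e\in T)=\frac7{12},\qquad \mathbf{P}(f\in T)=\frac{69}{140},\qquad \mathbf{P}(e\in T,\ f\in T)=\frac{145}{504},$$ and $$\frac{\mathbf{P}(e\in T,\ f\in T)}{\mathbf{P}(e\in T)\,\mathbf{P}(f\in T)}=\frac{1450}{1449}>1.$$
   Context: Since the weights are i.i.d. with an atomless law, all strict orders of the edges are equally likely, and the minimum spanning tree is determined by the order (Kruskal's algorithm). *)

theory Defs
  imports "HOL-Probability.Probability"
begin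

text \<open>
  A finite simple graph is given by a vertex set \<open>V\<close> and a set \<open>E\<close> of edges, each edge being
  a two-element subset of \<open>V\<close>. Subgraphs with vertex set \<open>V\<close> are identified with their edge sets.
\<close>

definition adj :: "'v set set \<Rightarrow> ('v \<times> 'v) set" where
  "adj F = {(u, v). {u, v} \<in> F}"

definition connects :: "'v set \<Rightarrow> 'v set set \<Rightarrow> bool" where
  "connects V F \<longleftrightarrow> (\<forall>u\<in>V. \<forall>v\<in>V. (u, v) \<in> (adj F)\<^sup>*)"

text \<open>
  A cycle is listed by its distinct vertices, without repeating the first one at the end.
\<close>

definition graph_cycle :: "'v set set \<Rightarrow> 'v list \<Rightarrow> bool" where
  "graph_cycle F p \<longleftrightarrow> 3 \<le> length p \<and> distinct p \<and>
     (\<forall>i<length p. {p ! i, p ! (Suc i mod length p)} \<in> F)"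

definition spanning_tree :: "'v set \<Rightarrow> 'v set set \<Rightarrow> 'v set set \<Rightarrow> bool" where
  "spanning_tree V E F \<longleftrightarrow> F \<subseteq> E \<and> connects V F \<and> (\<nexists>p. graph_cycle F p)"

definition minimum_spanning_tree ::
    "'v set \<Rightarrow> 'v set set \<Rightarrow> ('v set \<Rightarrow> real) \<Rightarrow> 'v set set \<Rightarrow> bool" where
  "minimum_spanning_tree V E w F \<longleftrightarrow> spanning_tree V E F \<and>
     (\<forall>F'. spanning_tree V E F' \<longrightarrow> (\<Sum>g\<in>F. w g) \<le> (\<Sum>g\<in>F'. w g))"

text \<open>Only meaningful for weights that admit exactly one minimum spanning tree.\<close>

definition the_mst :: "'v set \<Rightarrow> 'v set set \<Rightarrow> ('v set \<Rightarrow> real) \<Rightarrow> 'v set set" where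
  "the_mst V E w = (THE F. minimum_spanning_tree V E w F)"

datatype vertex = va | vb | vc | vd | vz

definition VG :: "vertex set" where
  "VG = {va, vb, vc, vd, vz}"

definition EG :: "vertex set set" where
  "EG = {{va, vb}, {va, vc}, {va, vd}, {va, vz}, {vb, vc}, {vb, vd}, {vb, vz}, {vc, vd}}"

definition edge_e :: "vertex set" where
  "edge_e = {va, vz}"

definition edge_f :: "vertex set" where
  "edge_f = {vc, vd}"

text \<open>For a law on the reals, having no atoms means that no single point is charged.\<close>

definition atomless :: "real measure \<Rightarrow> bool" where
  "atomless \<mu> \<longleftrightarrow> (\<forall>x. emeasure \<mu> {x} = 0)"

end

theory Submission
  imports Defs
begin

text \<open>
  For injective weights, an edge \<open>uv\<close> belongs to the minimum spanning tree if and only if \<open>u\<close> and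
  \<open>v\<close> are not connected by edges lighter than \<open>uv\<close>; this follows by exchanging edges. Ties have
  probability zero. Since the joint law of the weights is a power of \<open>\<mu>\<close>, all orders of the edges
  are equally likely, so that for a partition of the \<open>n\<close> edges into consecutive blocks, the
  probability that the weights increase from block to block is the product of the factorials of
  the block sizes divided by \<open>n!\<close>. Whether \<open>e\<close> and \<open>f\<close> lie in \<open>T\<close> depends only on which of
  the two is lighter and on the position (below, between or above) of the six other edges, so each
  probability is a sum over \<open>2 * 3 ^ 6\<close> configurations.
\<close>

subsection \<open>The exchange property of minimum spanning trees\<close>

lemma adj_rtrancl_sym: "(u, v) \<in> (adj F)\<^sup>* \<Longrightarrow> (v, u) \<in> (adj F)\<^sup>*"
  by (rule symD[OF sym_rtrancl]) (auto simp: sym_def adj_def insert_commute)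

lemma adj_rtrancl_mono: "(u, v) \<in> (adj F)\<^sup>* \<Longrightarrow> F \<subseteq> F' \<Longrightarrow> (u, v) \<in> (adj F')\<^sup>*"
  by (rule subsetD[OF rtrancl_mono]) (auto simp: adj_def)

lemma edge_rtrancl: "{u, v} \<in> F \<Longrightarrow> (u, v) \<in> (adj F)\<^sup>*"
  by (auto simp: adj_def)

lemma path_rtrancl_adj:
  "(u, x) \<in> (adj L)\<^sup>* \<Longrightarrow> {x, y} \<in> L \<Longrightarrow> (u, y) \<in> (adj L)\<^sup>*"
  by (meson edge_rtrancl rtrancl_trans)

text \<open>In the induction along the walk, a further crossing of the new edge leads to an endpoint
  that can be reached from \<open>s\<close> with at most one crossing.\<close>

lemma adj_rtrancl_insert:
  assumes "(s, t) \<in> (adj (insert {x, y} F))\<^sup>*"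
  shows "(s, t) \<in> (adj F)\<^sup>* \<or> (s, x) \<in> (adj F)\<^sup>* \<and> (y, t) \<in> (adj F)\<^sup>* \<or>
    (s, y) \<in> (adj F)\<^sup>* \<and> (x, t) \<in> (adj F)\<^sup>*"
  using assms
proof (induction rule: rtrancl_induct)
  case (step t t')
  then consider "{t, t'} \<in> F" | "t = x" "t' = y" | "t = y" "t' = x"
    by (auto simp: adj_def doubleton_eq_iff)
  then show ?case
  proof cases
    case 1
    then have "(t, t') \<in> (adj F)\<^sup>*" by (rule edge_rtrancl)
    with step.IH show ?thesis by (meson rtrancl_trans)
  next
    case 2
    with step.IH show ?thesis by (meson rtrancl.rtrancl_refl)
  next
    case 3
    with step.IH show ?thesis by (meson rtrancl.rtrancl_refl)
  qed
qed simp

lemma adj_rtrancl_remove: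
  assumes "(s, t) \<in> (adj F)\<^sup>*"
  shows "(s, t) \<in> (adj (F - {{x, y}}))\<^sup>* \<or>
    (s, x) \<in> (adj (F - {{x, y}}))\<^sup>* \<and> (y, t) \<in> (adj (F - {{x, y}}))\<^sup>* \<or>
    (s, y) \<in> (adj (F - {{x, y}}))\<^sup>* \<and> (x, t) \<in> (adj (F - {{x, y}}))\<^sup>*"
proof (rule adj_rtrancl_insert)
  show "(s, t) \<in> (adj (insert {x, y} (F - {{x, y}})))\<^sup>*"
    using assms by (rule adj_rtrancl_mono) auto
qed

text \<open>Extending a path by a vertex that it already visits closes a loop; cutting the path off
  at that vertex removes the loop.\<close>

lemma rtrancl_distinct_path:
  assumes "(u, v) \<in> R\<^sup>*"
  obtains p where "p \<noteq> []" "hd p = u" "last p = v" "distinct p" "successively (\<lambda>x y. (x, y) \<in> R) p"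
proof -
  have "\<exists>p. p \<noteq> [] \<and> hd p = u \<and> last p = v \<and> distinct p \<and> successively (\<lambda>x y. (x, y) \<in> R) p"
    using assms
  proof (induction rule: rtrancl_induct)
    case base
    show ?case by (rule exI[of _ "[u]"]) simp
  next
    case (step v v')
    then obtain p where p: "p \<noteq> []" "hd p = u" "last p = v" "distinct p"
      "successively (\<lambda>x y. (x, y) \<in> R) p" by blast
    show ?case
    proof (cases "v' \<in> set p")
      case True
      then obtain p1 p2 where "p = p1 @ v' # p2" by (meson split_list)
      with p show ?thesis
        by (intro exI[of _ "p1 @ [v']"]) (auto simp: successively_append_iff hd_append)
    next
      case False
      with p step.hyps show ?thesis
        by (intro exI[of _ "p @ [v']"]) (auto simp: successively_append_iff)
    qed
  qed
  with that show thesis by blast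
qed

text \<open>A walk from \<open>u\<close> to \<open>v\<close> avoiding the edge shortens to a path,
  which the edge closes to a cycle.\<close>

lemma acyclic_edge_bridge:
  assumes "\<nexists>p. graph_cycle F p" "{u, v} \<in> F" "u \<noteq> v"
  shows "(u, v) \<notin> (adj (F - {{u, v}}))\<^sup>*"
proof
  assume "(u, v) \<in> (adj (F - {{u, v}}))\<^sup>*"
  then obtain p where p: "p \<noteq> []" "hd p = u" "last p = v" "distinct p"
    "successively (\<lambda>x y. (x, y) \<in> adj (F - {{u, v}})) p" by (rule rtrancl_distinct_path)
  have step: "{p ! i, p ! Suc i} \<in> F - {{u, v}}" if "Suc i < length p" for i
    using p(5) that by (auto simp: successively_conv_nth adj_def)
  have ends: "p ! 0 = u" "p ! (length p - 1) = v"
    using p by (auto simp: hd_conv_nth last_conv_nth)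
  \<comment> \<open>A single vertex would mean \<open>u = v\<close>; two vertices would make the
    deleted edge a step of the path.\<close>
  have "length p \<noteq> 1" using ends assms(3) by auto
  moreover have "length p \<noteq> 2"
  proof
    assume "length p = 2"
    with step[of 0] ends show False by (simp add: numeral_2_eq_2)
  qed
  ultimately have len: "3 \<le> length p" using p(1) by (cases p) (auto simp: le_Suc_eq Suc_le_eq neq_Nil_conv length_Suc_conv eval_nat_numeral)
  have "{p ! i, p ! (Suc i mod length p)} \<in> F" if "i < length p" for i
  proof (cases "Suc i < length p")
    case True
    with step[of i] show ?thesis by simp
  next
    case False
    with that have "i = length p - 1" "Suc i = length p" by auto
    with ends assms(2) show ?thesis by (simp add: insert_commute)
  qed
  with len p(4) have "graph_cycle F p" by (auto simp: graph_cycle_def)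
  with assms(1) show False by blast
qed

text \<open>The edge joining the last vertex of a cycle to the first is no bridge, because the rest
  of the cycle connects its ends.\<close>

lemma bridges_acyclic:
  assumes "\<And>u v. {u, v} \<in> F \<Longrightarrow> u \<noteq> v \<Longrightarrow> (u, v) \<notin> (adj (F - {{u, v}}))\<^sup>*"
  shows "\<not> graph_cycle F p"
proof
  assume cyc: "graph_cycle F p"
  define n where "n = length p"
  from cyc have n: "3 \<le> n" "distinct p"
    and edge: "\<And>i. i < n \<Longrightarrow> {p ! i, p ! (Suc i mod n)} \<in> F"
    by (auto simp: graph_cycle_def n_def)
  have neq: "p ! i \<noteq> p ! j" if "i < n" "j < n" "i \<noteq> j" for i j
    using n that by (simp add: n_def nth_eq_iff_index_eq)
  let ?e = "{p ! 0, p ! (n - 1)}"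
  have "(p ! 0, p ! i) \<in> (adj (F - {?e}))\<^sup>*" if "i < n" for i
    using that
  proof (induction i)
    case (Suc i)
    have "{p ! i, p ! Suc i} \<in> F"
      using edge[of i] Suc.prems by simp
    \<comment> \<open>With at least three distinct vertices, no other edge of the cycle equals the
      closing edge \<open>?e\<close>.\<close>
    moreover have "{p ! i, p ! Suc i} \<noteq> ?e"
      using neq[of i 0] neq[of "Suc i" 0] neq[of "Suc i" "n - 1"] neq[of i "n - 1"] Suc.prems n(1)
      by (cases "i = 0") (auto simp: doubleton_eq_iff)
    ultimately have "(p ! i, p ! Suc i) \<in> adj (F - {?e})" by (simp add: adj_def)
    with Suc show ?case by (simp add: rtrancl.rtrancl_into_rtrancl)
  qed simp
  from this[of "n - 1"] have "(p ! 0, p ! (n - 1)) \<in> (adj (F - {?e}))\<^sup>*" using n by simp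
  moreover have "?e \<in> F" using edge[of "n - 1"] n by (simp add: insert_commute)
  moreover have "p ! 0 \<noteq> p ! (n - 1)" using neq[of 0 "n - 1"] n by simp
  ultimately show False using assms by blast
qed

text \<open>Some step of the walk leaves \<open>S\<close>. In a concrete graph, finitely many such
  cuts show what a connection requires, without enumerating walks.\<close>

lemma adj_rtrancl_crosses_cut:
  assumes "(u, v) \<in> (adj L)\<^sup>*" "u \<in> S" "v \<notin> S"
  shows "\<exists>g\<in>L. g \<inter> S \<noteq> {} \<and> \<not> g \<subseteq> S"
  using assms
proof (induction rule: rtrancl_induct)
  case (step x y)
  show ?case
  proof (cases "x \<in> S")
    case True
    with step show ?thesis by (intro bexI[of _ "{x, y}"]) (auto simp: adj_def)
  qed (use step in blast)
qed simp

section \<open>Spanning trees and edge exchange in a finite simple graph\<close>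

locale simple_graph =
  fixes V :: "'v set" and E :: "'v set set"
  assumes finite_edges: "finite E"
    and edgeE: "g \<in> E \<Longrightarrow> (\<And>u v. g = {u, v} \<Longrightarrow> u \<noteq> v \<Longrightarrow> u \<in> V \<Longrightarrow> v \<in> V \<Longrightarrow> thesis) \<Longrightarrow> thesis"
begin

text \<open>This trades cycles for bridges, so that exchange arguments need only reachability. The
  two notions agree because every edge has distinct ends.\<close>

lemma spanning_tree_iff_bridges:
  "spanning_tree V E F \<longleftrightarrow> F \<subseteq> E \<and> connects V F \<and>
    (\<forall>u v. {u, v} \<in> F \<longrightarrow> (u, v) \<notin> (adj (F - {{u, v}}))\<^sup>*)"
proof -
  have neq: "u \<noteq> v" if "{u, v} \<in> F" "F \<subseteq> E" for u v
    using that edgeE[of "{u, v}"] by (auto simp: doubleton_eq_iff)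
  have "(\<nexists>p. graph_cycle F p) \<longleftrightarrow> (\<forall>u v. {u, v} \<in> F \<longrightarrow> (u, v) \<notin> (adj (F - {{u, v}}))\<^sup>*)"
    if "F \<subseteq> E"
  proof
    assume "\<nexists>p. graph_cycle F p"
    then show "\<forall>u v. {u, v} \<in> F \<longrightarrow> (u, v) \<notin> (adj (F - {{u, v}}))\<^sup>*"
      by (intro allI impI acyclic_edge_bridge neq that)
  next
    assume "\<forall>u v. {u, v} \<in> F \<longrightarrow> (u, v) \<notin> (adj (F - {{u, v}}))\<^sup>*"
    then show "\<nexists>p. graph_cycle F p"
      using bridges_acyclic[of F] by simp
  qed
  then show ?thesis
    unfolding spanning_tree_def by metis
qed

text \<open>A connected edge set of least cardinality is a tree: deleting an edge that is not a
  bridge would keep it connected.\<close>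

lemma exists_spanning_tree:
  assumes "connects V E"
  shows "\<exists>F. spanning_tree V E F"
proof -
  define F where "F = (ARG_MIN card F. F \<subseteq> E \<and> connects V F)"
  have F: "F \<subseteq> E \<and> connects V F"
    unfolding F_def by (rule arg_min_natI[of _ E]) (use assms in auto)
  have minimal: "card F \<le> card F'" if "F' \<subseteq> E" "connects V F'" for F'
    unfolding F_def by (rule arg_min_nat_le) (use that in auto)
  have "(u, v) \<notin> (adj (F - {{u, v}}))\<^sup>*" if "{u, v} \<in> F" for u v
  proof
    assume conn: "(u, v) \<in> (adj (F - {{u, v}}))\<^sup>*"
    have "connects V (F - {{u, v}})"
      unfolding connects_def
    proof (intro ballI)
      fix s t assume "s \<in> V" "t \<in> V"
      with F have "(s, t) \<in> (adj F)\<^sup>*" by (auto simp: connects_def)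
      from adj_rtrancl_remove[OF this, of u v] conn adj_rtrancl_sym[OF conn]
      show "(s, t) \<in> (adj (F - {{u, v}}))\<^sup>*" by (meson rtrancl_trans)
    qed
    with minimal[of "F - {{u, v}}"] F have "card F \<le> card (F - {{u, v}})" by auto
    moreover have "card (F - {{u, v}}) < card F"
      using that F finite_edges by (meson card_Diff1_less finite_subset)
    ultimately show False by simp
  qed
  with F show ?thesis by (auto simp: spanning_tree_iff_bridges)
qed

lemma exists_minimum_spanning_tree:
  assumes "connects V E"
  shows "\<exists>F. minimum_spanning_tree V E w F"
proof -
  let ?S = "{F. spanning_tree V E F}"
  have "finite ?S" using finite_edges by (rule_tac finite_subset[of _ "Pow E"]) (auto simp: spanning_tree_def)
  moreover have "?S \<noteq> {}" using exists_spanning_tree[OF assms] by blast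
  ultimately show ?thesis
    using arg_min_if_finite[of ?S "\<lambda>F. \<Sum>g\<in>F. w g"] unfolding minimum_spanning_tree_def
    by (intro exI[of _ "arg_min_on (\<lambda>F. \<Sum>g\<in>F. w g) ?S"]) (force simp: not_less)
qed

text \<open>Deleting \<open>{u, v}\<close> splits the tree into the side of \<open>u\<close> and the
  side of \<open>v\<close>. By hypothesis \<open>x\<close> lies on the first and \<open>y\<close> on
  the second, so \<open>{x, y}\<close> joins the sides again without closing a cycle.\<close>

lemma spanning_tree_swap:
  assumes F: "spanning_tree V E F" and "{u, v} \<in> F" "{x, y} \<in> E"
    and ux: "(u, x) \<in> (adj (F - {{u, v}}))\<^sup>*" and yv: "(y, v) \<in> (adj (F - {{u, v}}))\<^sup>*"
  shows "spanning_tree V E (insert {x, y} (F - {{u, v}}))"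
proof -
  let ?D = "F - {{u, v}}"
  let ?F = "insert {x, y} ?D"
  from F have sub: "F \<subseteq> E" and conn: "connects V F"
    and bridge: "\<And>u v. {u, v} \<in> F \<Longrightarrow> (u, v) \<notin> (adj (F - {{u, v}}))\<^sup>*"
    by (auto simp: spanning_tree_iff_bridges)
  have xy_D: "(x, y) \<notin> (adj ?D)\<^sup>*"
    using bridge[OF assms(2)] ux yv by (meson rtrancl_trans)
  have "{x, y} \<notin> ?D" using xy_D edge_rtrancl by metis
  have "(u, v) \<in> (adj ?F)\<^sup>*"
  proof -
    have "(x, y) \<in> (adj ?F)\<^sup>*" by (rule edge_rtrancl) simp
    moreover have "(u, x) \<in> (adj ?F)\<^sup>*" "(y, v) \<in> (adj ?F)\<^sup>*"
      using ux yv by (auto elim: adj_rtrancl_mono)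
    ultimately show ?thesis by (meson rtrancl_trans)
  qed
  note uv = this adj_rtrancl_sym[OF this]
  have "connects V ?F"
    unfolding connects_def
  proof (intro ballI)
    fix s t assume "s \<in> V" "t \<in> V"
    with conn have "(s, t) \<in> (adj F)\<^sup>*" by (auto simp: connects_def)
    from adj_rtrancl_remove[OF this, of u v] uv
    show "(s, t) \<in> (adj ?F)\<^sup>*"
      by (meson adj_rtrancl_mono rtrancl_trans subset_insertI)
  qed
  moreover have "(s, t) \<notin> (adj (?F - {{s, t}}))\<^sup>*" if st: "{s, t} \<in> ?F" for s t
  proof (cases "{s, t} = {x, y}")
    case True
    then have "?F - {{s, t}} = ?D" using \<open>{x, y} \<notin> ?D\<close> by auto
    with True xy_D show ?thesis by (auto simp: doubleton_eq_iff dest: adj_rtrancl_sym)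
  next
    case False
    with st have stF: "{s, t} \<in> F" and stD: "{s, t} \<in> ?D" by auto
    show ?thesis
    proof
      assume "(s, t) \<in> (adj (?F - {{s, t}}))\<^sup>*"
      moreover have "?F - {{s, t}} = insert {x, y} (?D - {{s, t}})" using False by auto
      ultimately consider "(s, t) \<in> (adj (?D - {{s, t}}))\<^sup>*"
        | "(s, x) \<in> (adj (?D - {{s, t}}))\<^sup>*" "(y, t) \<in> (adj (?D - {{s, t}}))\<^sup>*"
        | "(s, y) \<in> (adj (?D - {{s, t}}))\<^sup>*" "(x, t) \<in> (adj (?D - {{s, t}}))\<^sup>*"
        using adj_rtrancl_insert[of s t x y "?D - {{s, t}}"] by auto
      then show False
      \<comment> \<open>A detour around \<open>{s, t}\<close> inside \<open>F\<close> contradicts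
        \<open>bridge\<close>. A detour through \<open>{x, y}\<close>, closed up by
        \<open>{s, t}\<close> itself, would join \<open>x\<close> to \<open>y\<close> inside
        \<open>?D\<close>.\<close>
      proof cases
        case 1
        then have "(s, t) \<in> (adj (F - {{s, t}}))\<^sup>*" by (rule adj_rtrancl_mono) auto
        with bridge[OF stF] show False by blast
      next
        case 2
        then have "(s, x) \<in> (adj ?D)\<^sup>*" "(y, t) \<in> (adj ?D)\<^sup>*" by (auto elim: adj_rtrancl_mono)
        with edge_rtrancl[OF stD] xy_D show False by (meson adj_rtrancl_sym rtrancl_trans)
      next
        case 3
        then have "(s, y) \<in> (adj ?D)\<^sup>*" "(x, t) \<in> (adj ?D)\<^sup>*" by (auto elim: adj_rtrancl_mono)
        with edge_rtrancl[OF stD] xy_D show False by (meson adj_rtrancl_sym rtrancl_trans)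
      qed
    qed
  qed
  ultimately show ?thesis using sub assms(3) by (auto simp: spanning_tree_iff_bridges)
qed

text \<open>The exchanged tree weighs at least as much as the minimum one, and the two sums differ
  only in the exchanged edges.\<close>

lemma minimum_spanning_tree_swap_le:
  assumes F: "minimum_spanning_tree V E w F" and "{u, v} \<in> F" "{x, y} \<in> E"
    and ux: "(u, x) \<in> (adj (F - {{u, v}}))\<^sup>*" and yv: "(y, v) \<in> (adj (F - {{u, v}}))\<^sup>*"
  shows "w {u, v} \<le> w {x, y}"
proof (cases "{x, y} \<in> F - {{u, v}}")
  case True
  have tree: "spanning_tree V E F" using F by (simp add: minimum_spanning_tree_def)
  \<comment> \<open>If \<open>{x, y}\<close> remained in the tree, it would join the two sides, and
    \<open>{u, v}\<close> would not be a bridge.\<close>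
  from True have "(u, v) \<in> (adj (F - {{u, v}}))\<^sup>*"
    using ux yv by (meson edge_rtrancl rtrancl_trans)
  with tree assms(2) show ?thesis by (auto simp: spanning_tree_iff_bridges)
next
  case False
  have tree: "spanning_tree V E F" using F by (simp add: minimum_spanning_tree_def)
  then have fin: "finite F" using finite_edges by (auto simp: spanning_tree_def dest: finite_subset)
  have "spanning_tree V E (insert {x, y} (F - {{u, v}}))"
    using tree assms(2-5) by (rule spanning_tree_swap)
  with F have "sum w F \<le> sum w (insert {x, y} (F - {{u, v}}))"
    by (simp add: minimum_spanning_tree_def)
  with False fin assms(2) show ?thesis by (simp add: sum.remove[of F "{u, v}"])
qed

text \<open>In a tree the path from \<open>u\<close> to \<open>v\<close> is unique. An edge whose
  deletion leaves them connected lies off this path, so all such edges can be deleted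
  together.\<close>

lemma connected_remove_all:
  assumes F: "spanning_tree V E F" and "finite H" "H \<subseteq> F" "(u, v) \<in> (adj F)\<^sup>*"
    and "\<And>g. g \<in> H \<Longrightarrow> (u, v) \<in> (adj (F - {g}))\<^sup>*"
  shows "(u, v) \<in> (adj (F - H))\<^sup>*"
  using assms(2-5)
proof (induction H rule: finite_induct)
  case (insert g H)
  then have gF: "g \<in> F" by simp
  then obtain s t where g: "g = {s, t}"
    using F edgeE by (metis spanning_tree_def subsetD)
  have uv: "(u, v) \<in> (adj (F - {g}))\<^sup>*" and "(u, v) \<in> (adj (F - H))\<^sup>*"
    using insert by auto
  from adj_rtrancl_remove[OF this(2), of s t] g have
    "(u, v) \<in> (adj (F - H - {g}))\<^sup>* \<or>
     (u, s) \<in> (adj (F - H - {g}))\<^sup>* \<and> (t, v) \<in> (adj (F - H - {g}))\<^sup>* \<or>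
     (u, t) \<in> (adj (F - H - {g}))\<^sup>* \<and> (s, v) \<in> (adj (F - H - {g}))\<^sup>*" by simp
  moreover have "(a, b) \<in> (adj (F - {g}))\<^sup>*" if "(a, b) \<in> (adj (F - H - {g}))\<^sup>*" for a b
    using that by (rule adj_rtrancl_mono) auto
  moreover have "(s, t) \<notin> (adj (F - {g}))\<^sup>*"
    using F gF g by (simp add: spanning_tree_iff_bridges)
  \<comment> \<open>A walk through \<open>g\<close> links \<open>u\<close> and \<open>v\<close> to
    different ends of \<open>g\<close>. As \<open>u\<close> and \<open>v\<close> are also connected
    in \<open>F - {g}\<close>, the edge \<open>g\<close> would not be a bridge.\<close>
  ultimately have "(u, v) \<in> (adj (F - H - {g}))\<^sup>*"
    using uv by (meson adj_rtrancl_sym rtrancl_trans)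
  then show ?case by (rule adj_rtrancl_mono) auto
qed simp

text \<open>This is Kruskal's criterion, and both directions are exchanges. A tree edge cannot be
  replaced by a lighter edge between its two sides. If \<open>{u, v}\<close> is left out, the tree
  path from \<open>u\<close> to \<open>v\<close> has no heavier edge, and injectivity makes all its
  edges strictly lighter.\<close>

theorem minimum_spanning_tree_edge_iff:
  assumes F: "minimum_spanning_tree V E w F" and inj: "inj_on w E" and uvE: "{u, v} \<in> E"
  shows "{u, v} \<in> F \<longleftrightarrow> (u, v) \<notin> (adj {g \<in> E. w g < w {u, v}})\<^sup>*"
proof -
  let ?e = "{u, v}"
  let ?L = "{g \<in> E. w g < w ?e}"
  have tree: "spanning_tree V E F" using F by (simp add: minimum_spanning_tree_def)
  then have sub: "F \<subseteq> E" and conn: "connects V F"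
    and bridge: "\<And>u v. {u, v} \<in> F \<Longrightarrow> (u, v) \<notin> (adj (F - {{u, v}}))\<^sup>*"
    by (auto simp: spanning_tree_iff_bridges)
  have uvV: "u \<in> V" "v \<in> V" using uvE by (auto elim!: edgeE simp: doubleton_eq_iff)
  with conn have uvF: "(u, v) \<in> (adj F)\<^sup>*" by (auto simp: connects_def)
  have "(u, v) \<notin> (adj ?L)\<^sup>*" if e: "?e \<in> F"
  proof
    assume "(u, v) \<in> (adj ?L)\<^sup>*"
    \<comment> \<open>A walk of lighter edges never leaves the side of \<open>u\<close>, since an
      edge crossing to the side of \<open>v\<close> could replace \<open>?e\<close> at lower
      weight.\<close>
    moreover have "(u, a) \<in> (adj (F - {?e}))\<^sup>*" if "(u, a) \<in> (adj ?L)\<^sup>*" for a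
      using that
    proof (induction rule: rtrancl_induct)
      case (step x y)
      then have xy: "{x, y} \<in> E" "w {x, y} < w ?e" by (auto simp: adj_def)
      then have "y \<in> V" by (auto elim!: edgeE simp: doubleton_eq_iff)
      with uvV conn have "(u, y) \<in> (adj F)\<^sup>*" by (auto simp: connects_def)
      from adj_rtrancl_remove[OF this, of u v]
      consider "(u, y) \<in> (adj (F - {?e}))\<^sup>*" | "(v, y) \<in> (adj (F - {?e}))\<^sup>*" by blast
      then show ?case
      proof cases
        case 2
        from minimum_spanning_tree_swap_le[OF F e xy(1) step.IH adj_rtrancl_sym[OF 2]] xy(2)
        show ?thesis by simp
      qed
    qed simp
    ultimately show False using bridge[OF e] by blast
  qed
  moreover have "(u, v) \<in> (adj ?L)\<^sup>*" if e: "?e \<notin> F"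
  proof -
    let ?H = "{g \<in> F. w ?e < w g}"
    \<comment> \<open>If deleting the heavier edge \<open>g\<close> separated \<open>u\<close> from
      \<open>v\<close>, then \<open>?e\<close> could replace \<open>g\<close> at lower
      weight.\<close>
    have heavy: "(u, v) \<in> (adj (F - {g}))\<^sup>*" if "g \<in> ?H" for g
    proof (rule ccontr)
      assume not: "(u, v) \<notin> (adj (F - {g}))\<^sup>*"
      from that have gF: "g \<in> F" and less: "w ?e < w g" by auto
      obtain s t where g: "g = {s, t}" using gF sub edgeE by (metis subsetD)
      from adj_rtrancl_remove[OF uvF, of s t] not g
      consider "(u, s) \<in> (adj (F - {{s, t}}))\<^sup>*" "(t, v) \<in> (adj (F - {{s, t}}))\<^sup>*"
        | "(u, t) \<in> (adj (F - {{s, t}}))\<^sup>*" "(s, v) \<in> (adj (F - {{s, t}}))\<^sup>*" by auto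
      then have "w g \<le> w ?e"
      proof cases
        case 1
        with minimum_spanning_tree_swap_le[OF F, of s t u v] gF g uvE show ?thesis
          by (auto dest: adj_rtrancl_sym)
      next
        case 2
        with minimum_spanning_tree_swap_le[OF F, of s t v u] gF g uvE show ?thesis
          by (auto dest: adj_rtrancl_sym simp: insert_commute)
      qed
      with less show False by simp
    qed
    have "finite ?H" using sub finite_edges by (auto dest: finite_subset)
    then have "(u, v) \<in> (adj (F - ?H))\<^sup>*"
      by (rule connected_remove_all[OF tree _ _ uvF heavy]) auto
    moreover have "F - ?H \<subseteq> ?L"
    proof
      fix g assume "g \<in> F - ?H"
      with e sub inj uvE have "g \<in> E" "w g \<noteq> w ?e" "\<not> w ?e < w g"
        by (auto simp: inj_on_def)
      then show "g \<in> ?L" by simp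
    qed
    ultimately show ?thesis by (rule adj_rtrancl_mono)
  qed
  ultimately show ?thesis by blast
qed

text \<open>The criterion decides the membership of each edge from the weights alone, so two minimum
  spanning trees coincide.\<close>

corollary ex1_minimum_spanning_tree:
  assumes "connects V E" "inj_on w E"
  shows "\<exists>!F. minimum_spanning_tree V E w F"
proof (rule ex_ex1I)
  show "\<exists>F. minimum_spanning_tree V E w F"
    using assms(1) by (rule exists_minimum_spanning_tree)
  fix F F' assume F: "minimum_spanning_tree V E w F" "minimum_spanning_tree V E w F'"
  then have "F \<subseteq> E" "F' \<subseteq> E" by (auto simp: minimum_spanning_tree_def spanning_tree_def)
  moreover have "g \<in> F \<longleftrightarrow> g \<in> F'" if g: "g \<in> E" for g
  proof -
    obtain u v where "g = {u, v}" using g edgeE by metis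
    then show ?thesis using minimum_spanning_tree_edge_iff[OF _ assms(2)] F g by auto
  qed
  ultimately show "F = F'" by blast
qed

corollary edge_in_the_mst_iff:
  assumes "connects V E" "inj_on w E" "{u, v} \<in> E"
  shows "{u, v} \<in> the_mst V E w \<longleftrightarrow> (u, v) \<notin> (adj {g \<in> E. w g < w {u, v}})\<^sup>*"
proof (rule minimum_spanning_tree_edge_iff[OF _ assms(2,3)])
  show "minimum_spanning_tree V E w (the_mst V E w)"
    unfolding the_mst_def by (rule theI'[OF ex1_minimum_spanning_tree[OF assms(1,2)]])
qed

end

text \<open>
  On the null event where the minimum spanning tree is not unique, \<open>the_mst\<close> is unspecified, and
  null sets need not be measurable subsets of \<open>M\<close>. But \<open>the_mst\<close> depends only on the set of
  minimum spanning trees, which takes finitely many values.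
\<close>

lemma the_mst_event:
  assumes "finite E" and X: "\<And>g. g \<in> E \<Longrightarrow> X g \<in> borel_measurable M"
  shows "{\<omega> \<in> space M. P (the_mst V E (\<lambda>g. X g \<omega>))} \<in> sets M"
proof -
  let ?S = "\<lambda>\<omega>. {F. minimum_spanning_tree V E (\<lambda>g. X g \<omega>) F}"
  have sub: "minimum_spanning_tree V E w F \<Longrightarrow> F \<subseteq> E" for w F
    by (simp add: minimum_spanning_tree_def spanning_tree_def)
  have "{\<omega> \<in> space M. minimum_spanning_tree V E (\<lambda>g. X g \<omega>) F} \<in> sets M" for F
  proof (cases "spanning_tree V E F")
    case True
    have fin: "finite {F'. spanning_tree V E F'}"
      using assms(1) by (rule_tac finite_subset[of _ "Pow E"]) (auto simp: spanning_tree_def)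
    have "{\<omega> \<in> space M. minimum_spanning_tree V E (\<lambda>g. X g \<omega>) F} =
        {\<omega> \<in> space M. \<forall>F'\<in>{F'. spanning_tree V E F'}. (\<Sum>g\<in>F. X g \<omega>) \<le> (\<Sum>g\<in>F'. X g \<omega>)}"
      using True by (auto simp: minimum_spanning_tree_def)
    also have "\<dots> \<in> sets M"
      using X True
      by (intro sets.sets_Collect_finite_All fin borel_measurable_le borel_measurable_sum)
        (auto simp: spanning_tree_def)
    finally show ?thesis .
  qed (simp add: minimum_spanning_tree_def)
  then have "{\<omega> \<in> space M. ?S \<omega> = S} \<in> sets M" if "S \<subseteq> Pow E" for S
  proof -
    assume mst: "\<And>F. {\<omega> \<in> space M. minimum_spanning_tree V E (\<lambda>g. X g \<omega>) F} \<in> sets M"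
    have "{\<omega> \<in> space M. ?S \<omega> = S} =
        {\<omega> \<in> space M. \<forall>F\<in>Pow E. minimum_spanning_tree V E (\<lambda>g. X g \<omega>) F \<longleftrightarrow> F \<in> S}"
      using that sub by (intro Collect_cong conj_cong refl) blast
    also have "\<dots> \<in> sets M"
    proof (intro sets.sets_Collect_finite_All)
      fix F
      show "{\<omega> \<in> space M. minimum_spanning_tree V E (\<lambda>g. X g \<omega>) F \<longleftrightarrow> F \<in> S} \<in> sets M"
        using mst[of F] sets.sets_Collect_neg[OF mst[of F]] by (cases "F \<in> S") simp_all
    qed (use assms(1) in simp)
    finally show ?thesis .
  qed
  then have "(\<Union>S\<in>{S \<in> Pow (Pow E). P (THE F. F \<in> S)}. {\<omega> \<in> space M. ?S \<omega> = S}) \<in> sets M"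
    using assms(1) by (intro sets.finite_UN) auto
  moreover have "?S \<omega> \<in> Pow (Pow E)" for \<omega> using sub by blast
  then have "(\<Union>S\<in>{S \<in> Pow (Pow E). P (THE F. F \<in> S)}. {\<omega> \<in> space M. ?S \<omega> = S}) =
      {\<omega> \<in> space M. P (the_mst V E (\<lambda>g. X g \<omega>))}"
    unfolding the_mst_def by auto
  ultimately show ?thesis by simp
qed

subsection \<open>The order of independent weights with an atomless law\<close>

lemma finite_sorted_key_list:
  fixes w :: "'a \<Rightarrow> 'b::linorder"
  assumes "finite A" "inj_on w A"
  obtains xs where "xs \<in> permutations_of_set A" "sorted_wrt (\<lambda>g h. w g < w h) xs"
proof -
  from assms(1) obtain l where l: "set l = A" "distinct l"
    using finite_distinct_list by blast
  let ?xs = "sort_key w l"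
  have "sorted_wrt (<) (map w ?xs)"
    using assms l by (simp add: strict_sorted_iff distinct_map)
  then have "sorted_wrt (\<lambda>g h. w g < w h) ?xs" by (simp add: sorted_wrt_map)
  moreover have "?xs \<in> permutations_of_set A" using l by (simp add: permutations_of_set_def)
  ultimately show thesis using that by blast
qed

text \<open>Both lists of weights are strictly increasing with the same entries, and strictness
  makes \<open>w\<close> injective on \<open>A\<close>. Consequently the events of different orders
  are disjoint.\<close>

lemma sorted_key_list_unique:
  fixes w :: "'a \<Rightarrow> 'b::linorder"
  assumes "xs \<in> permutations_of_set A" "ys \<in> permutations_of_set A"
    and "sorted_wrt (\<lambda>g h. w g < w h) xs" "sorted_wrt (\<lambda>g h. w g < w h) ys"
  shows "xs = ys"
proof -
  have strict: "sorted_wrt (<) (map w xs)" "sorted_wrt (<) (map w ys)"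
    using assms by (simp_all add: sorted_wrt_map)
  moreover have set: "set xs = A" "set ys = A"
    using assms by (simp_all add: permutations_of_set_def)
  ultimately have "map w xs = map w ys"
    by (intro strict_sorted_equal) simp_all
  moreover have "inj_on w A"
    using strict(1) set by (simp add: strict_sorted_iff distinct_map)
  ultimately show ?thesis using set by (simp add: inj_on_map_eq_map)
qed

text \<open>For disjoint finite blocks these are the linear extensions of the weak order whose
  classes are the listed blocks.\<close>

primrec block_orders :: "'a set list \<Rightarrow> 'a list set" where
  "block_orders [] = {[]}"
| "block_orders (B # Bs) = (\<lambda>(xs, ys). xs @ ys) ` (permutations_of_set B \<times> block_orders Bs)"

lemma finite_block_orders: "finite (block_orders Bs)"
  by (induction Bs) auto

text \<open>All permutations of \<open>B\<close> have the same length, so a concatenation determines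
  its two parts and the counts multiply.\<close>

lemma card_block_orders:
  "(\<And>B. B \<in> set Bs \<Longrightarrow> finite B) \<Longrightarrow> card (block_orders Bs) = (\<Prod>B\<leftarrow>Bs. fact (card B))"
proof (induction Bs)
  case (Cons B Bs)
  have "inj_on (\<lambda>(xs, ys). xs @ ys) (permutations_of_set B \<times> block_orders Bs)"
    by (auto simp: inj_on_def dest!: length_finite_permutations_of_set)
  with Cons show ?case by (simp add: card_image card_cartesian_product)
qed simp

lemma set_block_orders: "xs \<in> block_orders Bs \<Longrightarrow> set xs = \<Union>(set Bs)"
  by (induction Bs arbitrary: xs) (auto simp: permutations_of_set_def)

lemma distinct_block_orders:
  "xs \<in> block_orders Bs \<Longrightarrow> sorted_wrt (\<lambda>A B. A \<inter> B = {}) Bs \<Longrightarrow> distinct xs"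
proof (induction Bs arbitrary: xs)
  case (Cons B Bs)
  then obtain ys zs where "xs = ys @ zs" "ys \<in> permutations_of_set B" "zs \<in> block_orders Bs" by auto
  with Cons set_block_orders[of zs Bs] show ?case by (auto simp: permutations_of_set_def)
qed simp

text \<open>Each block can be sorted by weight, and the concatenation of the sorted blocks increases
  exactly when the weights increase from block to block. A comparison of blocks thus becomes a
  choice among finitely many total orders.\<close>

lemma sorted_block_orders_iff:
  fixes w :: "'a \<Rightarrow> 'b::linorder"
  assumes "\<And>B. B \<in> set Bs \<Longrightarrow> finite B" "inj_on w (\<Union>(set Bs))"
  shows "(\<exists>xs\<in>block_orders Bs. sorted_wrt (\<lambda>g h. w g < w h) xs) \<longleftrightarrow>
    sorted_wrt (\<lambda>A B. \<forall>a\<in>A. \<forall>b\<in>B. w a < w b) Bs"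
  using assms
proof (induction Bs)
  case (Cons B Bs)
  let ?s = "sorted_wrt (\<lambda>g h. w g < w h)"
  from Cons.prems have "finite B" "inj_on w B" by (auto simp: inj_on_Un)
  then obtain ys where ys: "ys \<in> permutations_of_set B" "?s ys" by (rule finite_sorted_key_list)
  have IH: "(\<exists>xs\<in>block_orders Bs. ?s xs) \<longleftrightarrow> sorted_wrt (\<lambda>A B. \<forall>a\<in>A. \<forall>b\<in>B. w a < w b) Bs"
    using Cons by (auto simp: inj_on_Un)
  have split: "?s (xs @ zs) \<longleftrightarrow> ?s xs \<and> ?s zs \<and> (\<forall>a\<in>B. \<forall>b\<in>\<Union>(set Bs). w a < w b)"
    if "xs \<in> permutations_of_set B" "zs \<in> block_orders Bs" for xs zs
    using set_block_orders[OF that(2)] that(1) by (simp add: sorted_wrt_append permutations_of_set_def)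
  have "(\<exists>xs\<in>block_orders (B # Bs). ?s xs) \<longleftrightarrow>
      (\<exists>xs\<in>permutations_of_set B. \<exists>zs\<in>block_orders Bs. ?s (xs @ zs))" by auto
  also have "\<dots> \<longleftrightarrow> (\<exists>zs\<in>block_orders Bs. ?s zs) \<and> (\<forall>a\<in>B. \<forall>b\<in>\<Union>(set Bs). w a < w b)"
    using ys split by blast
  finally show ?case unfolding IH by auto
qed simp

section \<open>Order probabilities for i.i.d. atomless weights\<close>

locale iid_atomless = prob_space +
  fixes \<mu> :: "real measure" and I :: "'i set" and X :: "'i \<Rightarrow> 'a \<Rightarrow> real"
  assumes indep: "indep_vars (\<lambda>_. borel) X I"
    and finite_I: "finite I"
    and law: "\<And>i. i \<in> I \<Longrightarrow> distr M borel (X i) = \<mu>"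
    and atomless: "atomless \<mu>"
begin

lemma measurable_X [measurable (raw)]: "i \<in> I \<Longrightarrow> X i \<in> borel_measurable M"
  using indep by (simp add: indep_vars_def)

text \<open>By independence the pair has the product law, and Fubini makes the diagonal
  \<open>D\<close> null because its sections are single points.\<close>

lemma AE_neq:
  assumes "i \<in> I" "j \<in> I" "i \<noteq> j"
  shows "AE \<omega> in M. X i \<omega> \<noteq> X j \<omega>"
proof -
  have "indep_var borel ((\<lambda>x. x i) \<circ> (\<lambda>\<omega>. \<lambda>k\<in>{i}. X k \<omega>)) borel ((\<lambda>x. x j) \<circ> (\<lambda>\<omega>. \<lambda>k\<in>{j}. X k \<omega>))"
    using assms by (intro indep_var_compose[OF indep_var_restrict[OF indep]]) auto
  then have ind: "indep_var borel (X i) borel (X j)" by (simp add: o_def)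
  have [measurable]: "X i \<in> borel_measurable M" "X j \<in> borel_measurable M"
    using assms measurable_X by auto
  interpret D: prob_space \<mu>
    using law[OF assms(1)] prob_space_distr[of "X i" borel] by simp
  have sets_mu [measurable_cong]: "sets \<mu> = sets borel" using law[OF assms(1)] by auto
  define D where "D = {z \<in> space (borel \<Otimes>\<^sub>M borel :: (real \<times> real) measure). fst z = snd z}"
  have D: "D \<in> sets (borel \<Otimes>\<^sub>M borel)" unfolding D_def by measurable
  have "emeasure (\<mu> \<Otimes>\<^sub>M \<mu>) D = (\<integral>\<^sup>+x. emeasure \<mu> (Pair x -` D) \<partial>\<mu>)"
    using D by (intro D.emeasure_pair_measure_alt) (simp add: sets_mu cong: sets_pair_measure_cong)
  also have "\<dots> = (\<integral>\<^sup>+x. emeasure \<mu> {x} \<partial>\<mu>)"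
    by (intro nn_integral_cong arg_cong2[where f = emeasure]) (auto simp: D_def space_pair_measure)
  also have "\<dots> = 0" using atomless by (simp add: atomless_def)
  finally have "emeasure (\<mu> \<Otimes>\<^sub>M \<mu>) D = 0" .
  moreover have "distr M borel (X i) \<Otimes>\<^sub>M distr M borel (X j) =
      distr M (borel \<Otimes>\<^sub>M borel) (\<lambda>\<omega>. (X i \<omega>, X j \<omega>))"
    using ind by (simp add: indep_var_distribution_eq)
  ultimately have "emeasure (distr M (borel \<Otimes>\<^sub>M borel) (\<lambda>\<omega>. (X i \<omega>, X j \<omega>))) D = 0"
    using law assms by simp
  then have "emeasure M ((\<lambda>\<omega>. (X i \<omega>, X j \<omega>)) -` D \<inter> space M) = 0"
    using D by (simp add: emeasure_distr)
  then show ?thesis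
    by (intro AE_I[of _ _ "(\<lambda>\<omega>. (X i \<omega>, X j \<omega>)) -` D \<inter> space M"])
      (auto simp: D_def space_pair_measure intro!: measurable_sets[OF _ D, unfolded D_def])
qed

lemma AE_inj: "AE \<omega> in M. inj_on (\<lambda>i. X i \<omega>) I"
proof -
  have "AE \<omega> in M. \<forall>i\<in>I. \<forall>j\<in>I. i \<noteq> j \<longrightarrow> X i \<omega> \<noteq> X j \<omega>"
    using finite_I AE_neq by (intro AE_finite_allI) auto
  then show ?thesis by eventually_elim (auto simp: inj_on_def)
qed

lemma sorted_event [measurable]:
  assumes "set xs \<subseteq> I"
  shows "{\<omega> \<in> space M. sorted_wrt (\<lambda>i j. X i \<omega> < X j \<omega>) xs} \<in> events"
proof -
  have "Measurable.pred M (\<lambda>\<omega>. sorted_wrt (\<lambda>i j. X i \<omega> < X j \<omega>) xs)"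
    using assms
  proof (induction xs)
    case (Cons x xs)
    then have [measurable]: "X x \<in> borel_measurable M" "\<And>y. y \<in> set xs \<Longrightarrow> X y \<in> borel_measurable M"
      "Measurable.pred M (\<lambda>\<omega>. sorted_wrt (\<lambda>i j. X i \<omega> < X j \<omega>) xs)"
      using measurable_X by auto
    show ?case by simp
  qed simp
  then show ?thesis by (simp add: pred_def)
qed

text \<open>The right-hand side does not depend on \<open>xs\<close>, so all orders are equally
  likely. The joint law is a power of \<open>\<mu>\<close>, and reading the coordinates in the order
  \<open>xs\<close> carries it to the power indexed by positions.\<close>

lemma prob_sorted_eq_PiM:
  assumes "xs \<in> permutations_of_set I"
  shows "prob {\<omega> \<in> space M. sorted_wrt (\<lambda>i j. X i \<omega> < X j \<omega>) xs} =
    measure (\<Pi>\<^sub>M k\<in>{..<card I}. \<mu>)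
      {y \<in> space (\<Pi>\<^sub>M k\<in>{..<card I}. \<mu>). sorted_wrt (\<lambda>k l. y k < y l) [0..<card I]}"
proof (cases "I = {}")
  \<comment> \<open>Without an index, \<open>\<mu>\<close> is not known to be a probability law;
    both sides are then the mass of the whole space.\<close>
  case True
  have "prob_space (\<Pi>\<^sub>M k\<in>{}. \<mu>)" by (rule prob_space_PiM) simp
  from prob_space.prob_space[OF this] True assms show ?thesis by (simp add: prob_space)
next
  case False
  let ?n = "card I"
  let ?P = "\<Pi>\<^sub>M k\<in>{..<?n}. \<mu>"
  let ?S = "{y \<in> space ?P. sorted_wrt (\<lambda>k l. y k < y l) [0..<?n]}"
  let ?r = "\<lambda>y. \<lambda>k\<in>{..<?n}. y (xs ! k)"
  from assms have xs: "set xs = I" "distinct xs" "length xs = ?n"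
    by (auto simp: permutations_of_set_def distinct_card)
  from False obtain i where "i \<in> I" by blast
  have prob_mu: "prob_space \<mu>"
    using law[OF \<open>i \<in> I\<close>] prob_space_distr[of "X i" borel] measurable_X \<open>i \<in> I\<close> by auto
  have sets_mu [measurable_cong]: "sets \<mu> = sets borel" using law[OF \<open>i \<in> I\<close>] by auto
  have nth: "xs ! k \<in> I" if "k < ?n" for k using that xs by (metis nth_mem)
  have X [measurable]: "(\<lambda>\<omega>. \<lambda>i\<in>I. X i \<omega>) \<in> M \<rightarrow>\<^sub>M (\<Pi>\<^sub>M i\<in>I. \<mu>)"
    using measurable_X by (intro measurable_restrict) (simp add: measurable_cong_sets[OF refl sets_mu])
  have r [measurable]: "?r \<in> (\<Pi>\<^sub>M i\<in>I. \<mu>) \<rightarrow>\<^sub>M ?P"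
    using nth by (intro measurable_restrict measurable_component_singleton) simp
  have "(\<Pi>\<^sub>M i\<in>I. \<mu>) = (\<Pi>\<^sub>M i\<in>I. distr M borel (X i))"
    using law by (intro PiM_cong) auto
  also have "\<dots> = distr M (\<Pi>\<^sub>M i\<in>I. borel) (\<lambda>\<omega>. \<lambda>i\<in>I. X i \<omega>)"
    using indep_vars_iff_distr_eq_PiM'[of I X "\<lambda>_. borel"] False measurable_X indep by simp
  also have "\<dots> = distr M (\<Pi>\<^sub>M i\<in>I. \<mu>) (\<lambda>\<omega>. \<lambda>i\<in>I. X i \<omega>)"
    by (intro distr_cong sets_PiM_cong) (simp_all add: sets_mu)
  finally have joint: "(\<Pi>\<^sub>M i\<in>I. \<mu>) = distr M (\<Pi>\<^sub>M i\<in>I. \<mu>) (\<lambda>\<omega>. \<lambda>i\<in>I. X i \<omega>)" .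
  \<comment> \<open>The map \<open>?r\<close> preserves the product law because the positions in the
    distinct list \<open>xs\<close> index \<open>I\<close> injectively.\<close>
  have "?P = distr (\<Pi>\<^sub>M i\<in>I. \<mu>) ?P ?r"
    using prob_mu nth xs
    by (subst distr_PiM_reindex[of I "\<lambda>_. \<mu>" "(!) xs" "{..<?n}"]) (auto simp: inj_on_nth)
  also have "\<dots> = distr M ?P (?r \<circ> (\<lambda>\<omega>. \<lambda>i\<in>I. X i \<omega>))"
    by (subst joint, rule distr_distr) measurable
  also have "?r \<circ> (\<lambda>\<omega>. \<lambda>i\<in>I. X i \<omega>) = (\<lambda>\<omega>. \<lambda>k\<in>{..<?n}. X (xs ! k) \<omega>)"
    using nth by (auto simp: fun_eq_iff)
  finally have P: "?P = distr M ?P (\<lambda>\<omega>. \<lambda>k\<in>{..<?n}. X (xs ! k) \<omega>)" .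
  have Y: "(\<lambda>\<omega>. \<lambda>k\<in>{..<?n}. X (xs ! k) \<omega>) \<in> M \<rightarrow>\<^sub>M ?P"
    using nth measurable_X by (intro measurable_restrict) (simp add: measurable_cong_sets[OF refl sets_mu])
  have S: "?S \<in> sets ?P"
  proof -
    have "?S = {y \<in> space ?P. \<forall>l\<in>{..<?n}. \<forall>k\<in>{..<l}. y k < y l}"
      by (auto simp: sorted_wrt_iff_nth_less)
    also have "\<dots> \<in> sets ?P"
    proof (intro sets.sets_Collect_finite_All)
      fix l k assume "l \<in> {..<?n}" "k \<in> {..<l}"
      then have [measurable]: "(\<lambda>y. y k) \<in> ?P \<rightarrow>\<^sub>M \<mu>" "(\<lambda>y. y l) \<in> ?P \<rightarrow>\<^sub>M \<mu>"
        by (auto intro!: measurable_component_singleton)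
      then have [measurable]: "(\<lambda>y. y k) \<in> borel_measurable ?P" "(\<lambda>y. y l) \<in> borel_measurable ?P"
        using measurable_cong_sets[OF refl sets_mu] by blast+
      show "{y \<in> space ?P. y k < y l} \<in> sets ?P" by measurable
    qed auto
    finally show ?thesis .
  qed
  have "measure ?P ?S = prob ((\<lambda>\<omega>. \<lambda>k\<in>{..<?n}. X (xs ! k) \<omega>) -` ?S \<inter> space M)"
    by (subst P, rule measure_distr[OF Y S])
  also have "(\<lambda>\<omega>. \<lambda>k\<in>{..<?n}. X (xs ! k) \<omega>) -` ?S \<inter> space M =
      {\<omega> \<in> space M. sorted_wrt (\<lambda>i j. X i \<omega> < X j \<omega>) xs}"
    using measurable_space[OF Y] xs by (auto simp: sorted_wrt_iff_nth_less)
  finally show ?thesis by simp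
qed

lemma prob_sorted_Union:
  assumes "L \<subseteq> permutations_of_set I"
  shows "prob {\<omega> \<in> space M. \<exists>xs\<in>L. sorted_wrt (\<lambda>i j. X i \<omega> < X j \<omega>) xs} =
    (\<Sum>xs\<in>L. prob {\<omega> \<in> space M. sorted_wrt (\<lambda>i j. X i \<omega> < X j \<omega>) xs})"
proof -
  have sets: "(\<lambda>xs. {\<omega> \<in> space M. sorted_wrt (\<lambda>i j. X i \<omega> < X j \<omega>) xs}) ` L \<subseteq> events"
    using assms by (auto intro!: sorted_event simp: permutations_of_set_def)
  have "disjoint_family_on (\<lambda>xs. {\<omega> \<in> space M. sorted_wrt (\<lambda>i j. X i \<omega> < X j \<omega>) xs}) L"
    unfolding disjoint_family_on_def
  proof safe
    fix xs ys \<omega> assume "xs \<in> L" "ys \<in> L" "xs \<noteq> ys"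
      "sorted_wrt (\<lambda>i j. X i \<omega> < X j \<omega>) xs" "sorted_wrt (\<lambda>i j. X i \<omega> < X j \<omega>) ys"
    with sorted_key_list_unique[of xs I ys "\<lambda>i. X i \<omega>"] assms show "\<omega> \<in> {}" by blast
  qed
  note finite_measure_finite_Union[OF finite_subset[OF assms finite_permutations_of_set] sets this]
  moreover have "(\<Union>xs\<in>L. {\<omega> \<in> space M. sorted_wrt (\<lambda>i j. X i \<omega> < X j \<omega>) xs}) =
      {\<omega> \<in> space M. \<exists>xs\<in>L. sorted_wrt (\<lambda>i j. X i \<omega> < X j \<omega>) xs}" by blast
  ultimately show ?thesis by simp
qed

text \<open>The events of the \<open>fact (card I)\<close> orders are disjoint and equally likely,
  and almost surely one of them occurs because ties are null.\<close>

lemma prob_sorted: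
  assumes "xs \<in> permutations_of_set I"
  shows "prob {\<omega> \<in> space M. sorted_wrt (\<lambda>i j. X i \<omega> < X j \<omega>) xs} = 1 / fact (card I)"
proof -
  let ?p = "prob {\<omega> \<in> space M. sorted_wrt (\<lambda>i j. X i \<omega> < X j \<omega>) xs}"
  let ?E = "{\<omega> \<in> space M. \<exists>ys\<in>permutations_of_set I. sorted_wrt (\<lambda>i j. X i \<omega> < X j \<omega>) ys}"
  have "AE \<omega> in M. \<exists>ys\<in>permutations_of_set I. sorted_wrt (\<lambda>i j. X i \<omega> < X j \<omega>) ys"
    using AE_inj by eventually_elim (metis finite_sorted_key_list finite_I)
  moreover have "?E \<in> events"
    by (intro sets.sets_Collect_finite_Ex sorted_event finite_permutations_of_set)
      (simp add: permutations_of_set_def)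
  ultimately have "1 = prob ?E" by (simp add: prob_Collect_eq_1)
  also have "\<dots> = (\<Sum>ys\<in>permutations_of_set I. ?p)"
    unfolding prob_sorted_Union[OF order_refl]
    by (intro sum.cong refl) (simp add: prob_sorted_eq_PiM assms)
  also have "\<dots> = fact (card I) * ?p" using finite_I by simp
  finally show ?thesis by (simp add: field_simps)
qed

text \<open>The description \<open>A_iff\<close> concerns tie-free weights only, which have
  probability one. There \<open>A\<close> is the disjoint union of the equally likely orders in
  \<open>block_orders Bs\<close>.\<close>

lemma prob_blocks:
  assumes Bs: "\<Union>(set Bs) = I" "sorted_wrt (\<lambda>A B. A \<inter> B = {}) Bs"
    and A: "A \<in> events"
    and A_iff: "\<And>\<omega>. \<omega> \<in> space M \<Longrightarrow> inj_on (\<lambda>i. X i \<omega>) I \<Longrightarrow>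
      \<omega> \<in> A \<longleftrightarrow> sorted_wrt (\<lambda>A B. \<forall>a\<in>A. \<forall>b\<in>B. X a \<omega> < X b \<omega>) Bs"
  shows "prob A = (\<Prod>B\<leftarrow>Bs. fact (card B)) / fact (card I)"
proof -
  let ?E = "{\<omega> \<in> space M. \<exists>xs\<in>block_orders Bs. sorted_wrt (\<lambda>i j. X i \<omega> < X j \<omega>) xs}"
  have fin: "finite B" if "B \<in> set Bs" for B
    using that Bs(1) finite_I by (auto intro: finite_subset[of _ I])
  have sub: "block_orders Bs \<subseteq> permutations_of_set I"
    using set_block_orders[of _ Bs] distinct_block_orders[of _ Bs] Bs
    by (auto simp: permutations_of_set_def)
  have "AE \<omega> in M. \<omega> \<in> A \<longleftrightarrow> \<omega> \<in> ?E"
    using AE_inj AE_space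
  proof eventually_elim
    case (elim \<omega>)
    with A_iff[of \<omega>] sorted_block_orders_iff[of Bs "\<lambda>i. X i \<omega>"] fin Bs(1) show ?case by simp
  qed
  moreover have "?E \<in> events"
    using sub finite_block_orders
    by (intro sets.sets_Collect_finite_Ex) (auto intro!: sorted_event simp: permutations_of_set_def)
  ultimately have "prob A = prob ?E" using A by (intro finite_measure_eq_AE)
  also have "\<dots> = (\<Sum>xs\<in>block_orders Bs. 1 / fact (card I))"
    unfolding prob_sorted_Union[OF sub] using sub by (intro sum.cong refl prob_sorted) auto
  also have "\<dots> = real (\<Prod>B\<leftarrow>Bs. fact (card B)) / fact (card I)"
    using card_block_orders[of Bs] fin by simp
  also have "real (\<Prod>B\<leftarrow>Bs. fact (card B)) = (\<Prod>B\<leftarrow>Bs. fact (card B))"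
    by (induction Bs) auto
  finally show ?thesis .
qed

end

section \<open>Positions of the other edges relative to two fixed edges\<close>

text \<open>
  When \<open>X e < X f\<close>, the position of another edge \<open>g\<close> relative to \<open>e\<close> and \<open>f\<close> is encoded by the
  pair \<open>(X g < X e, X g < X f)\<close>, so that the pair \<open>(True, False)\<close> cannot occur.
\<close>

definition position_types :: "(bool \<times> bool) list" where
  "position_types = [(True, True), (False, True), (False, False)]"

text \<open>For \<open>ls\<close> over \<open>position_types\<close>, this is the number of strict
  orders with \<open>e\<close> before \<open>f\<close> and the other edges placed as in
  \<open>ls\<close>: each of the three blocks is permuted freely, while \<open>{e}\<close> and
  \<open>{f}\<close> contribute the factor 1.\<close>

definition position_weight :: "(bool \<times> bool) list \<Rightarrow> int" where
  "position_weight ls = (\<Prod>t\<leftarrow>position_types. fact (count_list ls t))"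

text \<open>This counts the strict orders of \<open>n + 2\<close> edges with \<open>e\<close> before
  \<open>f\<close> whose positions satisfy \<open>Q\<close>; the list form allows direct
  evaluation.\<close>

definition position_count :: "nat \<Rightarrow> ((bool \<times> bool) list \<Rightarrow> bool) \<Rightarrow> int" where
  "position_count n Q = (\<Sum>ls\<leftarrow>filter Q (List.n_lists n position_types). position_weight ls)"

lemma card_nth_image_eq_count_list:
  assumes "distinct gs" "length ls = length gs"
  shows "card ((!) gs ` {i. i < length gs \<and> ls ! i = t}) = count_list ls t"
proof -
  have "inj_on ((!) gs) {i. i < length gs \<and> ls ! i = t}"
    using assms(1) by (intro inj_on_nth) auto
  then show ?thesis
    using assms(2) by (simp add: card_image count_list_eq_length_filter length_filter_conv_card eq_commute)
qed

context iid_atomless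
begin

lemma position_event:
  assumes "{e, f} \<union> set gs \<subseteq> I"
  shows "{\<omega> \<in> space M. X e \<omega> < X f \<omega> \<and> map (\<lambda>g. (X g \<omega> < X e \<omega>, X g \<omega> < X f \<omega>)) gs = ls} \<in> events"
proof -
  have "Measurable.pred M (\<lambda>\<omega>. map (\<lambda>g. (X g \<omega> < X e \<omega>, X g \<omega> < X f \<omega>)) gs = ls)"
    using assms
  proof (induction gs arbitrary: ls)
    case (Cons g gs)
    then have [measurable]: "X e \<in> borel_measurable M" "X f \<in> borel_measurable M" "X g \<in> borel_measurable M"
      "\<And>ls. Measurable.pred M (\<lambda>\<omega>. map (\<lambda>g. (X g \<omega> < X e \<omega>, X g \<omega> < X f \<omega>)) gs = ls)"
      using measurable_X by auto
    show ?case
    proof (cases ls)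
      case (Cons l ls')
      then show ?thesis by (cases l) simp
    qed simp
  qed simp
  moreover have [measurable]: "X e \<in> borel_measurable M" "X f \<in> borel_measurable M"
    using assms measurable_X by auto
  ultimately have "Measurable.pred M (\<lambda>\<omega>. X e \<omega> < X f \<omega> \<and>
      map (\<lambda>g. (X g \<omega> < X e \<omega>, X g \<omega> < X f \<omega>)) gs = ls)" by measurable
  then show ?thesis by (simp add: pred_def)
qed

text \<open>The positions amount to five consecutive blocks: the edges below \<open>e\<close>, then
  \<open>e\<close>, those between, then \<open>f\<close>, and those above.\<close>

lemma prob_position_eq:
  assumes I: "I = set (e # f # gs)" and dist: "distinct (e # f # gs)"
    and ls: "ls \<in> set (List.n_lists (length gs) position_types)"
  shows "prob {\<omega> \<in> space M. X e \<omega> < X f \<omega> \<and> map (\<lambda>g. (X g \<omega> < X e \<omega>, X g \<omega> < X f \<omega>)) gs = ls} =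
    position_weight ls / fact (length gs + 2)"
proof -
  define S where "S t = (!) gs ` {i. i < length gs \<and> ls ! i = t}" for t
  define Bs where "Bs = [S (True, True), {e}, S (False, True), {f}, S (False, False)]"
  have len: "length ls = length gs" and lsI: "set ls \<subseteq> set position_types"
    using ls by (auto simp: set_n_lists)
  have types: "ls ! i = (True, True) \<or> ls ! i = (False, True) \<or> ls ! i = (False, False)"
    if "i < length gs" for i
  proof -
    have "ls ! i \<in> set position_types" using that len lsI by (metis nth_mem subsetD)
    then show ?thesis by (auto simp: position_types_def)
  qed
  have S_sub: "S t \<subseteq> set gs" for t by (auto simp: S_def)
  have S_disj: "S t \<inter> S t' = {}" if "t \<noteq> t'" for t t'
    using dist that by (auto simp: S_def nth_eq_iff_index_eq)
  have S_Un: "S (True, True) \<union> S (False, True) \<union> S (False, False) = set gs"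
  proof -
    have "gs ! i \<in> S (True, True) \<union> S (False, True) \<union> S (False, False)" if "i < length gs" for i
      using types[OF that] that by (auto simp: S_def)
    then show ?thesis using S_sub by (fastforce simp: in_set_conv_nth)
  qed
  have "prob {\<omega> \<in> space M. X e \<omega> < X f \<omega> \<and> map (\<lambda>g. (X g \<omega> < X e \<omega>, X g \<omega> < X f \<omega>)) gs = ls} =
      (\<Prod>B\<leftarrow>Bs. fact (card B)) / fact (card I)"
  proof (rule prob_blocks)
    show "\<Union>(set Bs) = I" using S_Un by (auto simp: Bs_def I)
    show "sorted_wrt (\<lambda>A B. A \<inter> B = {}) Bs"
    proof -
      have "e \<notin> S t" "f \<notin> S t" for t using S_sub[of t] dist by auto
      then show ?thesis using S_disj dist by (auto simp: Bs_def)
    qed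
    fix \<omega> assume \<omega>: "\<omega> \<in> space M" and inj: "inj_on (\<lambda>i. X i \<omega>) I"
    let ?x = "\<lambda>g. X g \<omega>"
    let ?pos = "\<lambda>g. (?x g < ?x e, ?x g < ?x f)"
    have neq: "?x g \<noteq> ?x e" "?x g \<noteq> ?x f" if "g \<in> set gs" for g
      using inj that dist by (auto simp: I inj_on_def)
    have "map ?pos gs = ls \<longleftrightarrow> (\<forall>i<length gs. ?pos (gs ! i) = ls ! i)"
      using len by (auto simp: list_eq_iff_nth_eq)
    also have "\<dots> \<longleftrightarrow> (\<forall>t\<in>set position_types. \<forall>a\<in>S t. ?pos a = t)"
      using types by (fastforce simp: S_def position_types_def)
    also have "\<dots> \<longleftrightarrow> (\<forall>a\<in>S (True, True). ?x a < ?x e \<and> ?x a < ?x f) \<and>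
        (\<forall>a\<in>S (False, True). ?x e < ?x a \<and> ?x a < ?x f) \<and>
        (\<forall>a\<in>S (False, False). ?x e < ?x a \<and> ?x f < ?x a)"
    proof -
      \<comment> \<open>Without ties, a failed comparison is a strict one in the other
        direction.\<close>
      have "\<not> ?x a < ?x e \<longleftrightarrow> ?x e < ?x a" "\<not> ?x a < ?x f \<longleftrightarrow> ?x f < ?x a" if "a \<in> S t" for a t
        using neq[of a] S_sub[of t] that by auto
      then show ?thesis by (auto simp: position_types_def)
    qed
    finally have pos: "map ?pos gs = ls \<longleftrightarrow> \<dots>" .
    \<comment> \<open>Comparisons between two blocks of other edges follow by transitivity through
      \<open>e\<close> or \<open>f\<close>.\<close>
    have "sorted_wrt (\<lambda>A B. \<forall>a\<in>A. \<forall>b\<in>B. ?x a < ?x b) Bs \<longleftrightarrow> ?x e < ?x f \<and> map ?pos gs = ls"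
      unfolding pos Bs_def by (simp add: ball_Un) (meson less_trans)
    with \<omega> show "\<omega> \<in> {\<omega> \<in> space M. X e \<omega> < X f \<omega> \<and>
          map (\<lambda>g. (X g \<omega> < X e \<omega>, X g \<omega> < X f \<omega>)) gs = ls} \<longleftrightarrow>
        sorted_wrt (\<lambda>A B. \<forall>a\<in>A. \<forall>b\<in>B. X a \<omega> < X b \<omega>) Bs" by simp
  qed (use I in \<open>intro position_event; simp\<close>)
  also have "card I = length gs + 2"
    using distinct_card[OF dist] by (simp add: I)
  also have "(\<Prod>B\<leftarrow>Bs. fact (card B)) = real_of_int (position_weight ls)"
    using card_nth_image_eq_count_list[of gs ls] dist len
    by (simp add: Bs_def S_def position_weight_def position_types_def)
  finally show ?thesis .
qed

lemma prob_position:
  assumes I: "I = set (e # f # gs)" and dist: "distinct (e # f # gs)"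
  shows "{\<omega> \<in> space M. X e \<omega> < X f \<omega> \<and> Q (map (\<lambda>g. (X g \<omega> < X e \<omega>, X g \<omega> < X f \<omega>)) gs)} \<in> events"
      (is "?A \<in> _")
    and "prob {\<omega> \<in> space M. X e \<omega> < X f \<omega> \<and> Q (map (\<lambda>g. (X g \<omega> < X e \<omega>, X g \<omega> < X f \<omega>)) gs)} =
      position_count (length gs) Q / fact (length gs + 2)"
proof -
  let ?ls = "filter Q (List.n_lists (length gs) position_types)"
  let ?E = "\<lambda>ls. {\<omega> \<in> space M. X e \<omega> < X f \<omega> \<and> map (\<lambda>g. (X g \<omega> < X e \<omega>, X g \<omega> < X f \<omega>)) gs = ls}"
  have "map (\<lambda>g. (X g \<omega> < X e \<omega>, X g \<omega> < X f \<omega>)) gs \<in> set (List.n_lists (length gs) position_types)"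
    if "X e \<omega> < X f \<omega>" for \<omega>
    using that by (auto simp: set_n_lists position_types_def)
  then have A: "?A = (\<Union>ls\<in>set ?ls. ?E ls)" by auto
  have E: "?E ls \<in> events" for ls using I by (intro position_event) simp
  then show "?A \<in> events" unfolding A by (intro sets.finite_UN) auto
  have distinct: "distinct ?ls"
    by (intro distinct_filter distinct_n_lists) (simp add: position_types_def)
  have "prob ?A = (\<Sum>ls\<in>set ?ls. prob (?E ls))"
    unfolding A using E by (intro finite_measure_finite_Union) (auto simp: disjoint_family_on_def)
  also have "\<dots> = (\<Sum>ls\<in>set ?ls. position_weight ls / fact (length gs + 2))"
    using I dist by (intro sum.cong refl prob_position_eq) auto
  also have "\<dots> = (\<Sum>ls\<in>set ?ls. position_weight ls) / fact (length gs + 2)"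
    by (simp only: of_int_sum sum_divide_distrib)
  also have "(\<Sum>ls\<in>set ?ls. position_weight ls) = position_count (length gs) Q"
    unfolding position_count_def by (rule sum.distinct_set_conv_list[OF distinct])
  finally show "prob ?A = position_count (length gs) Q / fact (length gs + 2)" .
qed

text \<open>The case where \<open>f\<close> is lighter is the first case with the roles exchanged.
  Hence in \<open>Q'\<close> the first components compare with \<open>f\<close> and the second ones
  with \<open>e\<close>.\<close>

lemma prob_by_positions:
  assumes I: "I = set (e # f # gs)" and dist: "distinct (e # f # gs)"
    and A: "A \<in> events"
    and ef: "\<And>\<omega>. \<omega> \<in> space M \<Longrightarrow> inj_on (\<lambda>i. X i \<omega>) I \<Longrightarrow> X e \<omega> < X f \<omega> \<Longrightarrow>
      \<omega> \<in> A \<longleftrightarrow> Q (map (\<lambda>g. (X g \<omega> < X e \<omega>, X g \<omega> < X f \<omega>)) gs)"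
    and fe: "\<And>\<omega>. \<omega> \<in> space M \<Longrightarrow> inj_on (\<lambda>i. X i \<omega>) I \<Longrightarrow> X f \<omega> < X e \<omega> \<Longrightarrow>
      \<omega> \<in> A \<longleftrightarrow> Q' (map (\<lambda>g. (X g \<omega> < X f \<omega>, X g \<omega> < X e \<omega>)) gs)"
  shows "prob A = (position_count (length gs) Q + position_count (length gs) Q') / fact (length gs + 2)"
proof -
  let ?B = "{\<omega> \<in> space M. X e \<omega> < X f \<omega> \<and> Q (map (\<lambda>g. (X g \<omega> < X e \<omega>, X g \<omega> < X f \<omega>)) gs)}"
  let ?C = "{\<omega> \<in> space M. X f \<omega> < X e \<omega> \<and> Q' (map (\<lambda>g. (X g \<omega> < X f \<omega>, X g \<omega> < X e \<omega>)) gs)}"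
  have I': "I = set (f # e # gs)" and dist': "distinct (f # e # gs)"
    using I dist by auto
  note B = prob_position[OF I dist, of Q] and C = prob_position[OF I' dist', of Q']
  have "AE \<omega> in M. \<omega> \<in> A \<longleftrightarrow> \<omega> \<in> ?B \<union> ?C"
    using AE_inj AE_space
  proof eventually_elim
    case (elim \<omega>)
    then have "X e \<omega> \<noteq> X f \<omega>" using dist by (auto simp: I)
    then consider "X e \<omega> < X f \<omega>" | "X f \<omega> < X e \<omega>" by linarith
    then show ?case using ef[of \<omega>] fe[of \<omega>] elim by cases auto
  qed
  then have "prob A = prob (?B \<union> ?C)" using A B(1) C(1) by (intro finite_measure_eq_AE) auto
  also have "\<dots> = prob ?B + prob ?C"
    using B(1) C(1) by (intro finite_measure_Union) auto
  finally show ?thesis unfolding B(2) C(2) by (simp add: add_divide_distrib)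
qed

end

subsection \<open>The graph on five vertices\<close>

interpretation G: simple_graph VG EG
proof
  show "finite EG" by (simp add: EG_def)
  fix g thesis assume "g \<in> EG" and *: "\<And>u v. g = {u, v} \<Longrightarrow> u \<noteq> v \<Longrightarrow> u \<in> VG \<Longrightarrow> v \<in> VG \<Longrightarrow> thesis"
  then show thesis unfolding EG_def VG_def by auto
qed

text \<open>The vertex \<open>va\<close> is adjacent to all the others, so any two vertices are
  joined through it.\<close>

lemma connects_EG: "connects VG EG"
proof -
  have "(va, v) \<in> (adj EG)\<^sup>*" for v
    by (cases v) (auto simp: EG_def intro!: edge_rtrancl)
  then show ?thesis unfolding connects_def by (meson adj_rtrancl_sym rtrancl_trans)
qed

text \<open>The order of the entries is the one in which \<open>e_linked\<close> and
  \<open>f_linked\<close> read their list argument.\<close>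

definition other_edges :: "vertex set list" where
  "other_edges = [{va, vb}, {va, vc}, {va, vd}, {vb, vc}, {vb, vd}, {vb, vz}]"

lemma EG_eq: "EG = set (edge_e # edge_f # other_edges)"
  by (auto simp: EG_def edge_e_def edge_f_def other_edges_def)

lemma distinct_edges: "distinct (edge_e # edge_f # other_edges)"
  by (simp add: edge_e_def edge_f_def other_edges_def doubleton_eq_iff)

text \<open>
  The paths from \<open>a\<close> to \<open>z\<close> avoiding \<open>e\<close>, and below those from \<open>c\<close> to \<open>d\<close> avoiding \<open>f\<close>.
\<close>

fun e_linked :: "bool list \<Rightarrow> bool \<Rightarrow> bool" where
  "e_linked [ab, ac, ad, bc, bd, bz] cd \<longleftrightarrow>
    bz \<and> (ab \<or> ac \<and> bc \<or> ad \<and> bd \<or> ac \<and> cd \<and> bd \<or> ad \<and> cd \<and> bc)"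

fun f_linked :: "bool list \<Rightarrow> bool \<Rightarrow> bool" where
  "f_linked [ab, ac, ad, bc, bd, bz] az \<longleftrightarrow>
    ac \<and> ad \<or> bc \<and> bd \<or> (ab \<or> az \<and> bz) \<and> (ac \<and> bd \<or> ad \<and> bc)"

text \<open>With the quantifier over \<open>EG\<close>, each concrete cut unfolds to a finite
  disjunction of memberships in \<open>L\<close>.\<close>

lemma EG_cut:
  assumes "(u, v) \<in> (adj L)\<^sup>*" "L \<subseteq> EG" "u \<in> S" "v \<notin> S"
  shows "\<exists>g\<in>EG. g \<in> L \<and> g \<inter> S \<noteq> {} \<and> \<not> g \<subseteq> S"
  using adj_rtrancl_crosses_cut[OF assms(1,3,4)] assms(2) by blast

lemma e_linked_iff:
  assumes L: "L \<subseteq> EG" "edge_e \<notin> L"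
  shows "(va, vz) \<in> (adj L)\<^sup>* \<longleftrightarrow> e_linked (map (\<lambda>g. g \<in> L) other_edges) (edge_f \<in> L)"
proof
  assume conn: "(va, vz) \<in> (adj L)\<^sup>*"
  note cut = EG_cut[OF conn L(1)]
  \<comment> \<open>The first four cuts are all those separating \<open>va\<close> from
    \<open>vb\<close> with \<open>vz\<close> on the far side. The last one isolates
    \<open>vz\<close> and forces the edge \<open>bz\<close>, as \<open>az\<close> is not in
    \<open>L\<close>.\<close>
  from L(2) cut[of "{va}"] cut[of "{va, vc}"] cut[of "{va, vd}"] cut[of "{va, vc, vd}"]
    cut[of "{va, vb, vc, vd}"]
  show "e_linked (map (\<lambda>g. g \<in> L) other_edges) (edge_f \<in> L)"
    by (simp add: EG_def other_edges_def edge_e_def edge_f_def) blast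
next
  assume linked: "e_linked (map (\<lambda>g. g \<in> L) other_edges) (edge_f \<in> L)"
  have step: "(u, y) \<in> (adj L)\<^sup>*" if "(u, x) \<in> (adj L)\<^sup>*" "{x, y} \<in> L \<or> {y, x} \<in> L" for u x y
    using that path_rtrancl_adj[of u x L y] by (auto simp: insert_commute)
  show "(va, vz) \<in> (adj L)\<^sup>*"
    using linked unfolding other_edges_def edge_f_def
    by (simp, meson step rtrancl.rtrancl_refl)
qed

lemma f_linked_iff:
  assumes L: "L \<subseteq> EG" "edge_f \<notin> L"
  shows "(vc, vd) \<in> (adj L)\<^sup>* \<longleftrightarrow> f_linked (map (\<lambda>g. g \<in> L) other_edges) (edge_e \<in> L)"
proof
  assume conn: "(vc, vd) \<in> (adj L)\<^sup>*"
  note cut = EG_cut[OF conn L(1)]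
  \<comment> \<open>These are all the cuts between \<open>vc\<close> and \<open>vd\<close> except
    \<open>{vc, vz}\<close>, which is crossed by \<open>ac\<close> or \<open>bc\<close> as soon as
    \<open>{vc}\<close> is.\<close>
  from L(2) cut[of "{vc}"] cut[of "{vc, va}"] cut[of "{vc, vb}"] cut[of "{vc, va, vb}"]
    cut[of "{vc, va, vz}"] cut[of "{vc, vb, vz}"] cut[of "{vc, va, vb, vz}"]
  show "f_linked (map (\<lambda>g. g \<in> L) other_edges) (edge_e \<in> L)"
    by (simp add: EG_def other_edges_def edge_e_def edge_f_def) blast
next
  assume linked: "f_linked (map (\<lambda>g. g \<in> L) other_edges) (edge_e \<in> L)"
  have step: "(u, y) \<in> (adj L)\<^sup>*" if "(u, x) \<in> (adj L)\<^sup>*" "{x, y} \<in> L \<or> {y, x} \<in> L" for u x y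
    using that path_rtrancl_adj[of u x L y] by (auto simp: insert_commute)
  show "(vc, vd) \<in> (adj L)\<^sup>*"
    using linked unfolding other_edges_def edge_e_def
    by (simp, meson step rtrancl.rtrancl_refl)
qed

text \<open>Take \<open>L\<close> to be the edges lighter than the given edge, which is then not in
  \<open>L\<close> itself. Membership in the tree becomes a Boolean condition on weight
  comparisons.\<close>

lemma edges_in_mst_iff:
  assumes "inj_on w EG"
  shows edge_e_in_mst_iff: "edge_e \<in> the_mst VG EG w \<longleftrightarrow>
      \<not> e_linked (map (\<lambda>g. w g < w edge_e) other_edges) (w edge_f < w edge_e)"
    and edge_f_in_mst_iff: "edge_f \<in> the_mst VG EG w \<longleftrightarrow>
      \<not> f_linked (map (\<lambda>g. w g < w edge_f) other_edges) (w edge_e < w edge_f)"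
proof -
  have lower: "map (\<lambda>g. g \<in> {g \<in> EG. w g < c}) other_edges = map (\<lambda>g. w g < c) other_edges" for c
    by (simp add: EG_eq)
  have mem: "edge_e \<in> EG" "edge_f \<in> EG" by (simp_all add: EG_eq)
  have "edge_e \<in> the_mst VG EG w \<longleftrightarrow> (va, vz) \<notin> (adj {g \<in> EG. w g < w edge_e})\<^sup>*"
    using G.edge_in_the_mst_iff[OF connects_EG assms] mem unfolding edge_e_def by blast
  also have "\<dots> \<longleftrightarrow> \<not> e_linked (map (\<lambda>g. w g < w edge_e) other_edges) (w edge_f < w edge_e)"
    using e_linked_iff[of "{g \<in> EG. w g < w edge_e}"] mem unfolding lower by simp
  finally show "edge_e \<in> the_mst VG EG w \<longleftrightarrow>
      \<not> e_linked (map (\<lambda>g. w g < w edge_e) other_edges) (w edge_f < w edge_e)" .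
  have "edge_f \<in> the_mst VG EG w \<longleftrightarrow> (vc, vd) \<notin> (adj {g \<in> EG. w g < w edge_f})\<^sup>*"
    using G.edge_in_the_mst_iff[OF connects_EG assms] mem unfolding edge_f_def by blast
  also have "\<dots> \<longleftrightarrow> \<not> f_linked (map (\<lambda>g. w g < w edge_f) other_edges) (w edge_e < w edge_f)"
    using f_linked_iff[of "{g \<in> EG. w g < w edge_f}"] mem unfolding lower by simp
  finally show "edge_f \<in> the_mst VG EG w \<longleftrightarrow>
      \<not> f_linked (map (\<lambda>g. w g < w edge_f) other_edges) (w edge_e < w edge_f)" .
qed

text \<open>Among the 8! = 40320 orders, the first summand counts those with \<open>e\<close> before
  \<open>f\<close>, where \<open>fst\<close> compares with \<open>e\<close> and \<open>cd\<close> is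
  not lighter. In the second, \<open>f\<close> comes first, so \<open>snd\<close> compares with
  \<open>e\<close> and \<open>cd\<close> is lighter. The quotient 23520 / 40320 is 7/12.\<close>

lemma count_e:
  "position_count 6 (\<lambda>ls. \<not> e_linked (map fst ls) False) +
    position_count 6 (\<lambda>ls. \<not> e_linked (map snd ls) True) = 23520"
  by code_simp

text \<open>The summands keep the same two cases, but now the comparisons with \<open>f\<close>
  matter, so \<open>snd\<close> and \<open>fst\<close> change places. The quotient 19872 / 40320 is
  69/140.\<close>

lemma count_f:
  "position_count 6 (\<lambda>ls. \<not> f_linked (map snd ls) True) +
    position_count 6 (\<lambda>ls. \<not> f_linked (map fst ls) False) = 19872"
  by code_simp

text \<open>The quotient 11600 / 40320 is 145/504.\<close>

lemma count_e_f:
  "position_count 6 (\<lambda>ls. \<not> e_linked (map fst ls) False \<and> \<not> f_linked (map snd ls) True) +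
    position_count 6 (\<lambda>ls. \<not> e_linked (map snd ls) True \<and> \<not> f_linked (map fst ls) False) = 11600"
  by code_simp

theorem proposition4p3:
  fixes M :: "'w measure" and \<mu> :: "real measure"
    and X :: "vertex set \<Rightarrow> 'w \<Rightarrow> real" and T :: "'w \<Rightarrow> vertex set set"
  assumes "prob_space M"
    and "prob_space.indep_vars M (\<lambda>_. borel) X EG"
    and "\<And>g. g \<in> EG \<Longrightarrow> distr M borel (X g) = \<mu>"
    and "atomless \<mu>"
    and "\<And>\<omega>. T \<omega> = the_mst VG EG (\<lambda>g. X g \<omega>)"
  shows "(AE \<omega> in M. \<exists>!F. minimum_spanning_tree VG EG (\<lambda>g. X g \<omega>) F) \<and>
    measure M {\<omega> \<in> space M. edge_e \<in> T \<omega>} = 7 / 12 \<and>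
    measure M {\<omega> \<in> space M. edge_f \<in> T \<omega>} = 69 / 140 \<and>
    measure M {\<omega> \<in> space M. edge_e \<in> T \<omega> \<and> edge_f \<in> T \<omega>} = 145 / 504 \<and>
    measure M {\<omega> \<in> space M. edge_e \<in> T \<omega> \<and> edge_f \<in> T \<omega>} /
      (measure M {\<omega> \<in> space M. edge_e \<in> T \<omega>} * measure M {\<omega> \<in> space M. edge_f \<in> T \<omega>})
      = 1450 / 1449 \<and>
    (1450 / 1449 :: real) > 1"
proof -
  interpret prob_space M by fact
  interpret iid_atomless M \<mu> EG X
    using assms by unfold_locales (auto simp: G.finite_edges)
  note mst = edge_e_in_mst_iff edge_f_in_mst_iff
  have event: "{\<omega> \<in> space M. P (T \<omega>)} \<in> events" for P
    unfolding assms(5) by (rule the_mst_event[OF G.finite_edges measurable_X])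
  note prob = prob_by_positions[OF EG_eq distinct_edges event]
  have len: "length other_edges = 6" by (simp add: other_edges_def)
  \<comment> \<open>The six other edges together with \<open>e\<close> and \<open>f\<close> make
    eight, which gives the common denominator.\<close>
  have fact8: "fact 8 = (40320 :: real)" by (simp add: fact_numeral)
  have unique: "AE \<omega> in M. \<exists>!F. minimum_spanning_tree VG EG (\<lambda>g. X g \<omega>) F"
    using AE_inj by eventually_elim (rule G.ex1_minimum_spanning_tree[OF connects_EG])
  have e: "prob {\<omega> \<in> space M. edge_e \<in> T \<omega>} = 7 / 12"
    using prob[of "\<lambda>F. edge_e \<in> F" "\<lambda>ls. \<not> e_linked (map fst ls) False" "\<lambda>ls. \<not> e_linked (map snd ls) True"]
    by (simp add: assms(5) mst comp_def len fact8 count_e flip: of_int_add)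
  have f: "prob {\<omega> \<in> space M. edge_f \<in> T \<omega>} = 69 / 140"
    using prob[of "\<lambda>F. edge_f \<in> F" "\<lambda>ls. \<not> f_linked (map snd ls) True" "\<lambda>ls. \<not> f_linked (map fst ls) False"]
    by (simp add: assms(5) mst comp_def len fact8 count_f flip: of_int_add)
  have ef: "prob {\<omega> \<in> space M. edge_e \<in> T \<omega> \<and> edge_f \<in> T \<omega>} = 145 / 504"
    using prob[of "\<lambda>F. edge_e \<in> F \<and> edge_f \<in> F"
        "\<lambda>ls. \<not> e_linked (map fst ls) False \<and> \<not> f_linked (map snd ls) True"
        "\<lambda>ls. \<not> e_linked (map snd ls) True \<and> \<not> f_linked (map fst ls) False"]
    by (simp add: assms(5) mst comp_def len fact8 count_e_f flip: of_int_add)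
  show ?thesis using unique by (simp add: e f ef)
qed

end
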